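(* Let $I \subseteq \mathbb{R}$ be an open interval and let $S : I \to \mathbb{R}$ be a solution to equation $\mathbf{XX}$ on $I$ all of whose zeros (if any) are isolated. Then $S$ is three times differentiable on $I$ and satisfies, for all $t \in I$, the third-order equation $$S'''(t) = 12\, S(t)\, S'(t) + 4 t\, S'(t) + 2\, S(t).$$
   Context: Everything is real: $t$ is a real variable and solutions are real-valued. Equation $\mathbf{XX}$ is $$S'' = \frac{(S')^2}{2S} + 4 S^2 + 2 t S,$$ where the ratio $(S')^2/(2S)$ is understood as a limit at zeros of $S$. Precisely, a solution to $\mathbf{XX}$ on an open interval $I$ is a twice-differentiable function $S : I \to \mathbb{R}$ such that (i) at every $t \in I$ with $S(t) \neq 0$ one has $S''(t) = \frac{S'(t)^2}{2S(t)} + 4S(t)^2 + 2tS(t)$; and (ii) at every isolated zero $a \in I$ of $S$ the limit $\lim_{t \to a,\, t\neq a} \frac{S'(t)^2}{2S(t)}$ exists as a real number and $S''(a) = \lim_{t \to a} \frac{S'(t)^2}{2S(t)} + 4S(a)^2 + 2aS(a)$. *)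

theory Defs
  imports "HOL-Analysis.Analysis"
begin

text \<open>
  Functions on an open set \<open>I\<close> are rendered as total functions on the reals; on an open set,
  derivatives at points of \<open>I\<close>, and hence all notions below, depend only on the values on \<open>I\<close>.
  Each iterated derivative \<open>(deriv ^^ j) S\<close> is meaningful on \<open>I\<close> only together with
  differentiability of the preceding ones.
\<close>

definition times_differentiable_on :: "nat \<Rightarrow> (real \<Rightarrow> real) \<Rightarrow> real set \<Rightarrow> bool" where
  "times_differentiable_on k S I \<longleftrightarrow> (\<forall>j<k. (deriv ^^ j) S differentiable_on I)"

definition zeros_on :: "(real \<Rightarrow> real) \<Rightarrow> real set \<Rightarrow> real set" where
  "zeros_on S I = {t \<in> I. S t = 0}"

text \<open>
  The second-order equation \<open>S'' = (S')\<^sup>2 / (2 S) + 4 S\<^sup>2 + 2 t S\<close>, in which the quotient is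
  read as a limit at isolated zeros of \<open>S\<close>. Nothing is required at non-isolated zeros.
\<close>

definition XX_solution_on :: "(real \<Rightarrow> real) \<Rightarrow> real set \<Rightarrow> bool" where
  "XX_solution_on S I \<longleftrightarrow>
     times_differentiable_on 2 S I \<and>
     (\<forall>t\<in>I. S t \<noteq> 0 \<longrightarrow>
        (deriv ^^ 2) S t = (deriv S t)\<^sup>2 / (2 * S t) + 4 * (S t)\<^sup>2 + 2 * t * S t) \<and>
     (\<forall>a. a isolated_in zeros_on S I \<longrightarrow>
        (\<exists>L. ((\<lambda>t. (deriv S t)\<^sup>2 / (2 * S t)) \<longlongrightarrow> L) (at a) \<and>
             (deriv ^^ 2) S a = L + 4 * (S a)\<^sup>2 + 2 * a * S a))"

end

theory Submission
  imports Defs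
begin

text \<open>
  Write \<open>F t = 12 S S' + 4 t S' + 2 S\<close> for the right-hand side. Where \<open>S\<close> does not vanish,
  the second-order equation can be differentiated by the quotient rule; substituting the equation
  for \<open>S''\<close> into the result cancels the terms in \<open>S'\<^sup>3 / S\<^sup>2\<close> and leaves exactly \<open>F\<close>, which no
  longer has \<open>S\<close> in a denominator (lemma \<open>XX_rhs_has_real_derivative\<close>).

  At an isolated zero \<open>a\<close> of \<open>S\<close>, condition (ii) on a solution says precisely that \<open>S''\<close> is
  continuous at \<open>a\<close>. Since \<open>S'''\<close> equals \<open>F\<close> near \<open>a\<close>, and \<open>F\<close> is continuous at \<open>a\<close> because
  \<open>S\<close> and \<open>S'\<close> are, the derivative of \<open>S''\<close> has the limit \<open>F a\<close> at \<open>a\<close>. A continuous function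
  whose derivative has a limit at a point is differentiable there with that derivative
  (lemma \<open>has_real_derivative_from_limit\<close>).
\<close>

text \<open>This is l'Hospital's rule applied to the difference quotient of \<open>f\<close> at \<open>a\<close>.\<close>

lemma has_real_derivative_from_limit:
  fixes f f' :: "real \<Rightarrow> real"
  assumes cont: "isCont f a"
    and deriv: "\<forall>\<^sub>F x in at a. (f has_real_derivative f' x) (at x)"
    and lim: "(f' \<longlongrightarrow> D) (at a)"
  shows "(f has_real_derivative D) (at a)"
proof -
  have "((\<lambda>x. (f x - f a) / (x - a)) \<longlongrightarrow> D) (at a)"
  proof (rule lhopital)
    show "((\<lambda>x. f x - f a) \<longlongrightarrow> 0) (at a)"
      using cont by (simp add: isCont_def LIM_zero)
    show "((\<lambda>x. x - a) \<longlongrightarrow> 0) (at a)"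
      by (simp add: LIM_zero)
    show "\<forall>\<^sub>F x in at a. x - a \<noteq> 0"
      by (simp add: eventually_at_filter)
    show "\<forall>\<^sub>F x in at a. (1::real) \<noteq> 0"
      by simp
    show "\<forall>\<^sub>F x in at a. ((\<lambda>x. f x - f a) has_real_derivative f' x) (at x)"
      using deriv by eventually_elim (auto intro!: derivative_eq_intros)
    show "\<forall>\<^sub>F x in at a. ((\<lambda>x. x - a) has_real_derivative 1) (at x)"
      by (auto intro!: always_eventually derivative_eq_intros)
    show "((\<lambda>x. f' x / 1) \<longlongrightarrow> D) (at a)"
      using lim by simp
  qed
  then show ?thesis
    by (simp add: has_field_derivative_iff)
qed

lemma eventually_not_in_if_isolated_in:
  assumes "a isolated_in Z"
  shows "\<forall>\<^sub>F x in at a. x \<notin> Z"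
proof -
  obtain T where T: "open T" "T \<inter> Z = {a}"
    using assms by (auto simp: isolated_in_def)
  then have "\<forall>\<^sub>F x in at a. x \<in> T"
    by (intro eventually_at_in_open') auto
  moreover have "\<forall>\<^sub>F x in at a. x \<noteq> a"
    by (simp add: eventually_at_filter)
  ultimately show ?thesis
    by eventually_elim (use T in blast)
qed

lemma times_differentiable_on_imp_has_real_derivative:
  assumes "times_differentiable_on k S I" "open I" "t \<in> I" "j < k"
  shows "((deriv ^^ j) S has_real_derivative (deriv ^^ Suc j) S t) (at t)"
proof -
  have "(deriv ^^ j) S differentiable_on I"
    using assms(1,4) unfolding times_differentiable_on_def by blast
  then have "(deriv ^^ j) S differentiable at t"
    using assms(2,3) by (simp add: differentiable_on_eq_differentiable_at)
  then show ?thesis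
    by (simp add: DERIV_deriv_iff_real_differentiable)
qed

text \<open>
  Multiplied by \<open>2 S\<close>, the equation for \<open>q\<close> expresses \<open>2 S q\<close> as a polynomial in \<open>S\<close>, \<open>P\<close>
  and \<open>t\<close> whose term \<open>P\<^sup>2\<close> cancels the contribution of the derivative of \<open>1 / S\<close>. What is left
  in the numerator of the quotient rule is divisible by the denominator \<open>(2 S)\<^sup>2\<close>.
\<close>

lemma XX_rhs_has_real_derivative:
  fixes S P :: "real \<Rightarrow> real"
  assumes S: "(S has_real_derivative P t) (at t)"
    and P: "(P has_real_derivative q) (at t)"
    and nz: "S t \<noteq> 0"
    and q: "q = (P t)\<^sup>2 / (2 * S t) + 4 * (S t)\<^sup>2 + 2 * t * S t"
  shows "((\<lambda>x. (P x)\<^sup>2 / (2 * S x) + 4 * (S x)\<^sup>2 + 2 * x * S x) has_real_derivative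
    12 * S t * P t + 4 * t * P t + 2 * S t) (at t)"
proof -
  have "((\<lambda>x. (P x)\<^sup>2 / (2 * S x) + 4 * (S x)\<^sup>2 + 2 * x * S x) has_real_derivative
      (2 * P t * q * (2 * S t) - (P t)\<^sup>2 * (2 * P t)) / (2 * S t)\<^sup>2
      + 8 * S t * P t + (2 * S t + 2 * t * P t)) (at t)"
    by (rule derivative_eq_intros S P nz refl | (simp add: nz; fail))+
      (simp add: power2_eq_square ac_simps)
  moreover have "(2 * P t * q * (2 * S t) - (P t)\<^sup>2 * (2 * P t)) / (2 * S t)\<^sup>2
      = 4 * S t * P t + 2 * t * P t"
  proof -
    have "2 * S t * q = (P t)\<^sup>2 + 8 * S t ^ 3 + 4 * t * (S t)\<^sup>2"
      using nz q by (simp add: field_simps power2_eq_square power3_eq_cube)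
    then have "2 * P t * q * (2 * S t) = 2 * P t * ((P t)\<^sup>2 + 8 * S t ^ 3 + 4 * t * (S t)\<^sup>2)"
      by algebra
    then have "2 * P t * q * (2 * S t) - (P t)\<^sup>2 * (2 * P t)
        = (4 * S t * P t + 2 * t * P t) * (2 * S t)\<^sup>2"
      by algebra
    then show ?thesis
      using nz by simp
  qed
  ultimately show ?thesis
    by (simp add: algebra_simps)
qed

text \<open>
  Near a point with \<open>S \<noteq> 0\<close> the second derivative agrees with the right-hand side of the
  second-order equation, so it is differentiable there, although only two derivatives of \<open>S\<close>
  are assumed to exist.
\<close>

lemma XX_third_derivative_nonzero:
  assumes "open I" and sol: "XX_solution_on S I" and "t \<in> I" and nz: "S t \<noteq> 0"
  shows "((deriv ^^ 2) S has_real_derivative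
    12 * S t * deriv S t + 4 * t * deriv S t + 2 * S t) (at t)"
proof -
  have td: "times_differentiable_on 2 S I"
    using sol by (simp add: XX_solution_on_def)
  have eq: "(deriv ^^ 2) S x = (deriv S x)\<^sup>2 / (2 * S x) + 4 * (S x)\<^sup>2 + 2 * x * S x"
    if "x \<in> I" "S x \<noteq> 0" for x
    using sol that by (simp add: XX_solution_on_def)
  have d0: "(S has_real_derivative deriv S t) (at t)"
    using times_differentiable_on_imp_has_real_derivative[OF td assms(1,3), of 0] by simp
  have d1: "(deriv S has_real_derivative (deriv ^^ 2) S t) (at t)"
    using times_differentiable_on_imp_has_real_derivative[OF td assms(1,3), of 1]
    by (simp add: numeral_2_eq_2)
  note rhs = XX_rhs_has_real_derivative[OF d0 d1 nz eq[OF \<open>t \<in> I\<close> nz]]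
  have "\<forall>\<^sub>F x in nhds t. x \<in> I"
    using assms by (simp add: eventually_nhds_in_open)
  moreover have "\<forall>\<^sub>F x in nhds t. S x \<noteq> 0"
  proof -
    have "(S \<longlongrightarrow> S t) (nhds t)"
      using DERIV_isCont[OF d0] unfolding isCont_def
      by (rule tendsto_at_iff_tendsto_nhds[THEN iffD1])
    then show ?thesis
      using nz by (rule tendsto_imp_eventually_ne)
  qed
  ultimately have "\<forall>\<^sub>F x in nhds t.
      (deriv ^^ 2) S x = (deriv S x)\<^sup>2 / (2 * S x) + 4 * (S x)\<^sup>2 + 2 * x * S x"
    by eventually_elim (rule eq)
  from iffD2[OF DERIV_cong_ev[OF refl this refl] rhs] show ?thesis .
qed

lemma XX_third_derivative_isolated_zero:
  assumes "open I" and sol: "XX_solution_on S I" and iso: "a isolated_in zeros_on S I"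
  shows "((deriv ^^ 2) S has_real_derivative
    12 * S a * deriv S a + 4 * a * deriv S a + 2 * S a) (at a)"
proof (rule has_real_derivative_from_limit)
  have td: "times_differentiable_on 2 S I"
    using sol by (simp add: XX_solution_on_def)
  have "a \<in> I"
    using iso by (simp add: isolated_in_def zeros_on_def)
  have c0: "(S \<longlongrightarrow> S a) (at a)"
    using times_differentiable_on_imp_has_real_derivative[OF td assms(1) \<open>a \<in> I\<close>, of 0,
        THEN DERIV_isCont]
    by (simp add: isCont_def)
  have c1: "(deriv S \<longlongrightarrow> deriv S a) (at a)"
    using times_differentiable_on_imp_has_real_derivative[OF td assms(1) \<open>a \<in> I\<close>, of 1,
        THEN DERIV_isCont]
    by (simp add: isCont_def)
  have "\<forall>\<^sub>F x in at a. x \<in> I"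
    using assms(1) \<open>a \<in> I\<close> by (intro eventually_at_in_open')
  with eventually_not_in_if_isolated_in[OF iso]
  have ev: "\<forall>\<^sub>F x in at a. x \<in> I \<and> S x \<noteq> 0"
    by eventually_elim (simp add: zeros_on_def)
  show "isCont ((deriv ^^ 2) S) a"
  proof -
    obtain L where L: "((\<lambda>t. (deriv S t)\<^sup>2 / (2 * S t)) \<longlongrightarrow> L) (at a)"
      and val: "(deriv ^^ 2) S a = L + 4 * (S a)\<^sup>2 + 2 * a * S a"
      using sol iso unfolding XX_solution_on_def by blast
    have "\<forall>\<^sub>F x in at a.
        (deriv S x)\<^sup>2 / (2 * S x) + 4 * (S x)\<^sup>2 + 2 * x * S x = (deriv ^^ 2) S x"
      using ev by eventually_elim (use sol in \<open>simp add: XX_solution_on_def\<close>)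
    moreover have "((\<lambda>x. (deriv S x)\<^sup>2 / (2 * S x) + 4 * (S x)\<^sup>2 + 2 * x * S x)
        \<longlongrightarrow> L + 4 * (S a)\<^sup>2 + 2 * a * S a) (at a)"
      by (intro tendsto_intros L c0)
    ultimately show ?thesis
      unfolding isCont_def val by (rule Lim_transform_eventually[rotated])
  qed
  show "\<forall>\<^sub>F x in at a. ((deriv ^^ 2) S has_real_derivative
      12 * S x * deriv S x + 4 * x * deriv S x + 2 * S x) (at x)"
    using ev by eventually_elim (rule XX_third_derivative_nonzero[OF assms(1) sol], simp_all)
  show "((\<lambda>x. 12 * S x * deriv S x + 4 * x * deriv S x + 2 * S x)
      \<longlongrightarrow> 12 * S a * deriv S a + 4 * a * deriv S a + 2 * S a) (at a)"
    by (intro tendsto_add tendsto_mult tendsto_const tendsto_ident_at c0 c1)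
qed

theorem theorem1:
  fixes I :: "real set" and S :: "real \<Rightarrow> real"
  assumes "open I" and "is_interval I"
    and "XX_solution_on S I"
    and "\<forall>a \<in> zeros_on S I. a isolated_in zeros_on S I"
  shows "times_differentiable_on 3 S I \<and>
    (\<forall>t\<in>I. (deriv ^^ 3) S t = 12 * S t * deriv S t + 4 * t * deriv S t + 2 * S t)"
proof -
  have third: "((deriv ^^ 2) S has_real_derivative
      12 * S t * deriv S t + 4 * t * deriv S t + 2 * S t) (at t)" if "t \<in> I" for t
  proof (cases "S t = 0")
    case True
    with that have "t isolated_in zeros_on S I"
      using assms(4) by (simp add: zeros_on_def)
    then show ?thesis
      by (rule XX_third_derivative_isolated_zero[OF assms(1,3)])
  next
    case False
    then show ?thesis
      by (rule XX_third_derivative_nonzero[OF assms(1,3) that])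
  qed
  have "(deriv ^^ 2) S differentiable_on I"
    by (intro differentiable_at_imp_differentiable_on)
      (auto intro: third simp: real_differentiable_def)
  moreover have "times_differentiable_on 2 S I"
    using assms(3) by (simp add: XX_solution_on_def)
  moreover have "j < 2 \<or> j = 2" if "j < 3" for j :: nat
    using that by linarith
  ultimately have "times_differentiable_on 3 S I"
    unfolding times_differentiable_on_def by metis
  moreover have "(deriv ^^ 3) S t = 12 * S t * deriv S t + 4 * t * deriv S t + 2 * S t"
    if "t \<in> I" for t
    using DERIV_imp_deriv[OF third[OF that]] by (simp add: numeral_3_eq_3 numeral_2_eq_2)
  ultimately show ?thesis
    by blast
qed

end
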